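(* Let $n\ge 0$ be an integer, $N=2^n$, let $M\ge 1$ be an integer, let $\eta_e,\eta_r,\eta_d,\lambda,\lambda_m\in(0,1]$ and $P_e,P_r,P_d\in[0,1)$ with $P_r\neq 1/2$. Let $\rho_i$, $1\le i\le n+1$, be the two-qubit states of the repeater chain, and let $P_1$, $Q_i$, $P_s(i)$, $P_{\rm succ}$ be the quantities defined in the context. Put $$A_r=\eta_r\lambda_m+P_r(1-\eta_r\lambda_m),\qquad B_r=1-(1-P_r)(1-\eta_r\lambda_m)^2,$$ $$a=\tfrac18\left[P_r^2(1-A_r)^2+A_r^2(1-P_r)^2\right],\quad b=\tfrac18\left[2A_rP_r(1-A_r)(1-P_r)\right],\quad c=\tfrac18P_r(1-P_r)\left[P_r(1-B_r)+B_r(1-P_r)\right],$$ and let $a_e,b_e,c_e$ be given by the same formulas as $a,b,c$ with $(P_r,A_r,B_r)$ replaced by $(P_e,A_e,B_e)$, where $A_e=\eta_e\lambda+P_e(1-\eta_e\lambda)$ and $B_e=1-(1-P_e)(1-\eta_e\lambda)^2$. Put $s=a+b+2c$, $s_1=a_e+b_e+2c_e$, $w_r=c/(a+b)$, $w_1=c_e/(a_e+b_e)$, and $$A_d=\eta_d+(1-\eta_d)P_d,\quad q_1=(1-P_d)A_d,\quad q_2=(1-A_d)P_d,\quad q_3=P_dA_d,$$ $$t_e=\frac{1-2w_1}{1+2w_1},\qquad t_r=\frac{1-2w_r}{1+2w_r},\qquad t_d=\left(\frac{q_1-q_2}{q_1+q_2+q_3}\right)^2 .$$ Then: 1. (Sift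 probability) The probability that Alice and Bob use the same measurement basis is $1/2$, and conditioned on this the probability of a successful sift is, for every $i$, $P_1=(q_1+q_2+q_3)^2$. 2. (QBER) For $1\le i\le n+1$, $$Q_i=\frac12\left[1-\frac{t_d}{t_r}\,(t_rt_e)^{2^{i-1}}\right].$$ Moreover, for each $x\in\{e,r,d\}$, $t_x=1$ whenever $P_x=0$. 3. (Success probabilities) $P_s(1)=1-(1-4s_1)^M$ and $P_s(i)=4s$ for $2\le i\le n+1$; consequently, with $P_s=4s$, $P_{\rm succ}=P_s^{N-1}P_s(1)^N$, that is, $$P_{\rm succ}=\frac{1}{4s}\left[4s\left(1-(1-4s_1)^M\right)\right]^{2^n}.$$
   Context: Qubits and Bell states. A qubit is carried by two bosonic modes containing exactly one photon in total, with basis $|10\rangle,|01\rangle$ (photon-number states of the first and second mode). Two-qubit basis states: $|\psi_0\rangle=|01,01\rangle$, $|\psi_1\rangle=|01,10\rangle$, $|\psi_2\rangle=|10,01\rangle$, $|\psi_3\rangle=|10,10\rangle$; $|M^\pm\rangle=(|\psi_2\rangle\pm|\psi_1\rangle)/\sqrt2$. Detectors. A single-photon detector with dark-click probability $P$ and efficiency $\hat\eta$, acting on a mode with at most two photons, is the two-outcome POVM $F_0=(1-P)\left[\Pi_0+(1-\hat\eta)\Pi_1+(1-\hat\eta)^2\Pi_2\right]$ ("no click") and $F_1=\mathbb I-F_0$ ("click"), where $\Pi_k=|k\rangle\langle k|$ is the projector on the $k$-photon state. Transmission loss is absorbed in the efficiency. Bell-state measurement and swap. Given two-qubit states $\sigma_{ab}$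 and $\tau_{cd}$, with qubit $b$ on modes $b_1,b_2$ and qubit $c$ on modes $c_1,c_2$, a Bell-state measurement (BSM) with detector parameters $(P,\hat\eta)$ first applies the beamsplitter unitary $U$ with $b_j^\dagger\mapsto(b_j^\dagger+c_j^\dagger)/\sqrt2$, $c_j^\dagger\mapsto(b_j^\dagger-c_j^\dagger)/\sqrt2$ ($j=1,2$, creation operators), and then detects the four modes $b_1,b_2,c_1,c_2$ (numbered $1,2,3,4$) with four such detectors. The BSM is successful if the set of clicking detectors is exactly $\{1,2\}$, $\{3,4\}$, $\{1,4\}$ or $\{2,3\}$. If $E$ is the POVM element of the outcome (e.g. $E=F_1\otimes F_1\otimes F_0\otimes F_0$ for $\{1,2\}$), the resulting state of $ad$ is ${\rm tr}_{bc}\left(\sqrt E\,U(\sigma\otimes\tau)U^\dagger\sqrt E\right)$ divided by the probability of the outcome; for the outcomes $\{1,4\}$ and $\{2,3\}$ the heralded sign is corrected by the phase flip $|01\rangle\mapsto-|01\rangle$ on qubit $d$ (interchanging the roles of $|M^+\rangle$ and $|M^-\rangle$), so that all four successful outcomes herald the same state, called the swapped state. Chain. $\rho_1$ is the swapped state obtained from $|M^+\rangle_{ab}|M^+\rangle_{cd}$ with detector parameters $(P_e,\eta_e\lambda)$; $P_{s0}$ is the total probability of the four successful outcomes of this BSM, and $P_s(1)=1-(1-P_{s0})^M$ (success in at least one of $M$ independent frequency modes). For $i\ge 2$, $\rho_i$ is the swapped state obtained from two copies of $\rho_{i-1}$ with detector parameters $(P_r,\eta_r\lambda_m)$, and $P_s(i)$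 is the total probability of the four successful outcomes of this BSM. With $N=2^n$ elementary links, $P_{\rm succ}=P_s(n+1)\,P_s(n)^2\cdots P_s(2)^{2^{n-1}}\,P_s(1)^{2^n}$. ($\lambda$ is the transmittance of half an elementary link, $\lambda_m$ the memory efficiency.) Sifting and QBER. Alice holds the first and Bob the second qubit of $\rho_i$; each independently chooses one of two measurement bases uniformly at random. The four modes of $\rho_i$ are detected by four detectors with parameters $(P_d,\eta_d)$; let $F_0,F_1$ be the corresponding POVM elements and $M_{jklm}=F_j\otimes F_k\otimes F_l\otimes F_m$. Conditioned on equal bases, the sift probability (neither party gets no click on both modes) is $$P_1={\rm Tr}\left[\rho_i(M_{0101}+M_{0110}+M_{1001}+M_{1010}+M_{1101}+M_{1110}+M_{0111}+M_{1011}+M_{1111})\right],$$ and the QBER (conditional probability of mismatched bits, where Alice reads $(0,1)\to0$, $(1,0)\to1$, Bob reads $(0,1)\to1$, $(1,0)\to0$, and $(1,1)$ is read as a uniformly random bit) is $$Q_i=\frac1{P_1}{\rm Tr}\left[\rho_i\left(M_{0101}+M_{1010}+\tfrac12\{M_{1101}+M_{1110}+M_{0111}+M_{1011}+M_{1111}\}\right)\right].$$ *)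

theory Defs
  imports "HOL-Probability.Probability"
begin

section \<open>Operators on finite-dimensional spaces with a labelled orthonormal basis\<close>

definition dagger :: "complex^'n^'m \<Rightarrow> complex^'m^'n" where
  "dagger A = (\<chi> i j. cnj (A $ j $ i))"

definition tensor ::
  "complex^'n::finite^'n \<Rightarrow> complex^'m::finite^'m \<Rightarrow> complex^('n \<times> 'm)^('n \<times> 'm)" where
  "tensor A B = (\<chi> i j. A $ fst i $ fst j * B $ snd i $ snd j)"

definition pure_state :: "complex^'n \<Rightarrow> complex^'n^'n" where
  "pure_state v = (\<chi> i j. v $ i * cnj (v $ j))"

definition positive_op :: "complex^'n::finite^'n \<Rightarrow> bool" where
  "positive_op A \<longleftrightarrow> dagger A = A \<and> (\<forall>v. 0 \<le> Re (\<Sum>i\<in>UNIV. cnj (v $ i) * (A *v v) $ i))"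

text \<open>For positive \<open>A\<close> the positive square root exists and is unique, so that the choice is immaterial.\<close>

definition op_sqrt :: "complex^'n::finite^'n \<Rightarrow> complex^'n^'n" where
  "op_sqrt A = (SOME R. positive_op R \<and> R ** R = A)"


section \<open>Modes, qubits and Bell states\<close>

text \<open>Every mode is cut off at two photons. Each beamsplitter acts on two modes that
  together contain at most two photons, so the cutoff never affects a state that occurs.\<close>

datatype occupation = Zero | One | Two

fun photons :: "occupation \<Rightarrow> nat" where
  "photons Zero = 0"
| "photons One = 1"
| "photons Two = 2"

instance occupation :: finite
proof
  have "(UNIV :: occupation set) = {Zero, One, Two}"
    by (auto intro: occupation.exhaust)
  then show "finite (UNIV :: occupation set)"
    by (metis finite.emptyI finite_insert)
qed

text \<open>A pair of modes carries a qubit; a two-qubit state is a density operator on the space of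
  four modes.\<close>

type_synonym mode_pair = "occupation \<times> occupation"
type_synonym four_modes = "mode_pair \<times> mode_pair"
type_synonym four_mode_op = "complex^four_modes^four_modes"

abbreviation q10 :: mode_pair where "q10 \<equiv> (One, Zero)"
abbreviation q01 :: mode_pair where "q01 \<equiv> (Zero, One)"

definition M_plus :: "complex^four_modes" where
  "M_plus = (1 / sqrt 2) *\<^sub>R (axis (q10, q01) 1 + axis (q01, q10) 1)"


section \<open>Detectors\<close>

definition proj_photons :: "nat \<Rightarrow> complex^occupation^occupation" where
  "proj_photons k = (\<chi> i j. if i = j \<and> photons i = k then 1 else 0)"

definition no_click :: "real \<Rightarrow> real \<Rightarrow> complex^occupation^occupation" where
  "no_click P \<eta> =
     (1 - P) *\<^sub>R (proj_photons 0 + (1 - \<eta>) *\<^sub>R proj_photons 1 + (1 - \<eta>)^2 *\<^sub>R proj_photons 2)"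

definition detector :: "real \<Rightarrow> real \<Rightarrow> nat \<Rightarrow> complex^occupation^occupation" where
  "detector P \<eta> j = (if j = 0 then no_click P \<eta> else mat 1 - no_click P \<eta>)"

definition four_detectors :: "real \<Rightarrow> real \<Rightarrow> nat \<Rightarrow> nat \<Rightarrow> nat \<Rightarrow> nat \<Rightarrow> four_mode_op" where
  "four_detectors P \<eta> j k l m =
     tensor (tensor (detector P \<eta> j) (detector P \<eta> k)) (tensor (detector P \<eta> l) (detector P \<eta> m))"


section \<open>Bell-state measurement and swap\<close>

definition creation :: "complex^occupation^occupation" where
  "creation = (\<chi> m n. if photons m = photons n + 1 then of_real (sqrt (photons m)) else 0)"

definition create_b1 :: four_mode_op where
  "create_b1 = tensor (tensor creation (mat 1)) (tensor (mat 1) (mat 1))"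
definition create_b2 :: four_mode_op where
  "create_b2 = tensor (tensor (mat 1) creation) (tensor (mat 1) (mat 1))"
definition create_c1 :: four_mode_op where
  "create_c1 = tensor (tensor (mat 1) (mat 1)) (tensor creation (mat 1))"
definition create_c2 :: four_mode_op where
  "create_c2 = tensor (tensor (mat 1) (mat 1)) (tensor (mat 1) creation)"

definition vacuum :: "complex^four_modes" where
  "vacuum = axis ((Zero, Zero), (Zero, Zero)) 1"

text \<open>The number state with occupations \<open>k1, k2, l1, l2\<close> of the modes \<open>b1, b2, c1, c2\<close> is obtained
  from the vacuum by the corresponding powers of the creation operators, divided by
  the square root of \<open>k1! k2! l1! l2!\<close>. Column \<open>k\<close> of the matrix is its image, in which
  every creation operator has been substituted and the vacuum is kept fixed.
  With the cutoff, the matrix is the compression of the unitary on the full Fock space; it is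
  isometric on the number states with at most two photons in total.\<close>

definition beamsplitter :: four_mode_op where
  "beamsplitter = (\<chi> m k.
     let k1 = photons (fst (fst k)); k2 = photons (snd (fst k));
         l1 = photons (fst (snd k)); l2 = photons (snd (snd k));
         B1 = (*v) ((1 / sqrt 2) *\<^sub>R (create_b1 + create_c1));
         B2 = (*v) ((1 / sqrt 2) *\<^sub>R (create_b2 + create_c2));
         C1 = (*v) ((1 / sqrt 2) *\<^sub>R (create_b1 - create_c1));
         C2 = (*v) ((1 / sqrt 2) *\<^sub>R (create_b2 - create_c2))
     in ((1 / sqrt (fact k1 * fact k2 * fact l1 * fact l2)) *\<^sub>R
          (B1 ^^ k1) ((B2 ^^ k2) ((C1 ^^ l1) ((C2 ^^ l2) vacuum)))) $ m)"

text \<open>The systems \<open>a, b, c, d\<close> are grouped as \<open>((a, b), (c, d))\<close>.\<close>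

type_synonym eight_mode_op = "complex^(four_modes \<times> four_modes)^(four_modes \<times> four_modes)"

definition on_bc :: "four_mode_op \<Rightarrow> eight_mode_op" where
  "on_bc X = (\<chi> i j. case (i, j) of (((a, b), (c, d)), ((a', b'), (c', d'))) \<Rightarrow>
     if a = a' \<and> d = d' then X $ (b, c) $ (b', c') else 0)"

definition trace_bc :: "eight_mode_op \<Rightarrow> four_mode_op" where
  "trace_bc R = (\<chi> i j. case (i, j) of ((a, d), (a', d')) \<Rightarrow>
     (\<Sum>b\<in>UNIV. \<Sum>c\<in>UNIV. R $ ((a, b), (c, d)) $ ((a', b), (c, d'))))"

definition after_beamsplitter :: "four_mode_op \<Rightarrow> four_mode_op \<Rightarrow> eight_mode_op" where
  "after_beamsplitter \<sigma> \<tau> = on_bc beamsplitter ** tensor \<sigma> \<tau> ** dagger (on_bc beamsplitter)"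

text \<open>An outcome is the set of the numbers of the clicking detectors on \<open>b1, b2, c1, c2\<close>.\<close>

definition bsm_successes :: "nat set set" where
  "bsm_successes = {{1, 2}, {3, 4}, {1, 4}, {2, 3}}"

definition bsm_element :: "real \<Rightarrow> real \<Rightarrow> nat set \<Rightarrow> four_mode_op" where
  "bsm_element P \<eta> S = four_detectors P \<eta>
     (of_bool (1 \<in> S)) (of_bool (2 \<in> S)) (of_bool (3 \<in> S)) (of_bool (4 \<in> S))"

definition bsm_prob :: "real \<Rightarrow> real \<Rightarrow> four_mode_op \<Rightarrow> four_mode_op \<Rightarrow> nat set \<Rightarrow> real" where
  "bsm_prob P \<eta> \<sigma> \<tau> S = Re (trace (on_bc (bsm_element P \<eta> S) ** after_beamsplitter \<sigma> \<tau>))"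

definition bsm_post_state ::
  "real \<Rightarrow> real \<Rightarrow> four_mode_op \<Rightarrow> four_mode_op \<Rightarrow> nat set \<Rightarrow> four_mode_op" where
  "bsm_post_state P \<eta> \<sigma> \<tau> S =
     (let K = on_bc (op_sqrt (bsm_element P \<eta> S))
      in (1 / bsm_prob P \<eta> \<sigma> \<tau> S) *\<^sub>R trace_bc (K ** after_beamsplitter \<sigma> \<tau> ** K))"

text \<open>The phase flip on qubit \<open>d\<close>, extended by the identity outside the qubit space.\<close>

definition phase_flip_d :: four_mode_op where
  "phase_flip_d = tensor (mat 1) (\<chi> i j. if i = j then (if i = q01 then -1 else 1) else 0)"

definition heralded_state ::
  "real \<Rightarrow> real \<Rightarrow> four_mode_op \<Rightarrow> four_mode_op \<Rightarrow> nat set \<Rightarrow> four_mode_op" where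
  "heralded_state P \<eta> \<sigma> \<tau> S =
     (if S \<in> {{1, 4}, {2, 3}}
      then phase_flip_d ** bsm_post_state P \<eta> \<sigma> \<tau> S ** dagger phase_flip_d
      else bsm_post_state P \<eta> \<sigma> \<tau> S)"

text \<open>The common state heralded by all four successful outcomes. It does not exist for
  arbitrary inputs, but it does for those that occur in the repeater chain.\<close>

definition swapped_state ::
  "real \<Rightarrow> real \<Rightarrow> four_mode_op \<Rightarrow> four_mode_op \<Rightarrow> four_mode_op" where
  "swapped_state P \<eta> \<sigma> \<tau> = (THE \<rho>. \<forall>S\<in>bsm_successes. heralded_state P \<eta> \<sigma> \<tau> S = \<rho>)"

definition swap_prob :: "real \<Rightarrow> real \<Rightarrow> four_mode_op \<Rightarrow> four_mode_op \<Rightarrow> real" where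
  "swap_prob P \<eta> \<sigma> \<tau> = (\<Sum>S\<in>bsm_successes. bsm_prob P \<eta> \<sigma> \<tau> S)"


section \<open>The repeater chain\<close>

text \<open>The detector parameters are \<open>(P\<^sub>e, x\<^sub>e)\<close> in the elementary links and \<open>(P\<^sub>r, x\<^sub>r)\<close> in the
  repeater stations. Levels are counted from \<open>1\<close>; level \<open>0\<close> is left unspecified.\<close>

fun chain_state :: "real \<Rightarrow> real \<Rightarrow> real \<Rightarrow> real \<Rightarrow> nat \<Rightarrow> four_mode_op" where
  "chain_state P\<^sub>e x\<^sub>e P\<^sub>r x\<^sub>r (Suc 0) = swapped_state P\<^sub>e x\<^sub>e (pure_state M_plus) (pure_state M_plus)"
| "chain_state P\<^sub>e x\<^sub>e P\<^sub>r x\<^sub>r (Suc (Suc i)) =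
     (let \<rho> = chain_state P\<^sub>e x\<^sub>e P\<^sub>r x\<^sub>r (Suc i) in swapped_state P\<^sub>r x\<^sub>r \<rho> \<rho>)"

definition level_prob :: "nat \<Rightarrow> real \<Rightarrow> real \<Rightarrow> real \<Rightarrow> real \<Rightarrow> nat \<Rightarrow> real" where
  "level_prob M P\<^sub>e x\<^sub>e P\<^sub>r x\<^sub>r i =
     (if i = 1
      then 1 - (1 - swap_prob P\<^sub>e x\<^sub>e (pure_state M_plus) (pure_state M_plus))^M
      else (let \<rho> = chain_state P\<^sub>e x\<^sub>e P\<^sub>r x\<^sub>r (i - 1) in swap_prob P\<^sub>r x\<^sub>r \<rho> \<rho>))"

definition chain_prob :: "nat \<Rightarrow> real \<Rightarrow> real \<Rightarrow> real \<Rightarrow> real \<Rightarrow> nat \<Rightarrow> real" where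
  "chain_prob M P\<^sub>e x\<^sub>e P\<^sub>r x\<^sub>r n = (\<Prod>i = 1..n + 1. level_prob M P\<^sub>e x\<^sub>e P\<^sub>r x\<^sub>r i ^ 2 ^ (n + 1 - i))"


section \<open>Sifting and QBER\<close>

text \<open>The bases chosen by Alice and by Bob, each labelled by a truth value.\<close>

definition basis_choices :: "(bool \<times> bool) pmf" where
  "basis_choices = pair_pmf (pmf_of_set UNIV) (pmf_of_set UNIV)"

text \<open>The sift probability is conditional on equal bases.\<close>

definition sift_prob :: "real \<Rightarrow> real \<Rightarrow> four_mode_op \<Rightarrow> real" where
  "sift_prob P \<eta> \<rho> = (let F = four_detectors P \<eta> in
     Re (trace (\<rho> ** (F 0 1 0 1 + F 0 1 1 0 + F 1 0 0 1 + F 1 0 1 0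
       + F 1 1 0 1 + F 1 1 1 0 + F 0 1 1 1 + F 1 0 1 1 + F 1 1 1 1))))"

definition qber :: "real \<Rightarrow> real \<Rightarrow> four_mode_op \<Rightarrow> real" where
  "qber P \<eta> \<rho> = (let F = four_detectors P \<eta> in
     1 / sift_prob P \<eta> \<rho> *
     Re (trace (\<rho> ** (F 0 1 0 1 + F 1 0 1 0
       + (1 / 2) *\<^sub>R (F 1 1 0 1 + F 1 1 1 0 + F 0 1 1 1 + F 1 0 1 1 + F 1 1 1 1)))))"

end

theory Submission
  imports Defs
begin

text \<open>All states of the chain lie in a three-parameter family: weights \<open>(1 + u) / 4\<close> on each of
  \<open>\<psi>\<^sub>1, \<psi>\<^sub>2\<close>, weights \<open>(1 - u) / 4\<close> on each of \<open>\<psi>\<^sub>0, \<psi>\<^sub>3\<close>, and a real coherence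
  between \<open>\<psi>\<^sub>1\<close> and \<open>\<psi>\<^sub>2\<close>. On the qubit space, the measurement operator \<open>U\<^sup>\<dagger> E U\<close> of a
  successful outcome \<open>E\<close> is \<open>4 a\<close> on one of \<open>M\<^sup>\<plusminus>\<close>, \<open>4 b\<close> on the other and \<open>4 c\<close> on \<open>\<psi>\<^sub>0\<close> and \<open>\<psi>\<^sub>3\<close>.
  Hence a swap preserves the family, succeeds with probability \<open>s\<close> for each outcome whatever the
  state, and sends \<open>u\<close> to \<open>t u\<^sup>2\<close> with \<open>t = (a + b - 2 c) / s\<close>, starting from \<open>u = 1\<close> for \<open>M\<^sup>+\<close>.
  Sifting and error rate see only the weights, so that \<open>Q = (1 - t\<^sub>d u) / 2\<close>.\<close>

section \<open>Diagonal operators\<close>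

definition diag_op :: "('n \<Rightarrow> real) \<Rightarrow> complex^'n::finite^'n" where
  "diag_op f = (\<chi> i j. if i = j then of_real (f i) else 0)"

lemma diag_op_nth: "diag_op f $ i $ j = (if i = j then of_real (f i) else 0)"
  by (simp add: diag_op_def)

lemma diag_op_mult_nth: "(diag_op f ** A) $ i $ j = of_real (f i) * A $ i $ j"
  by (simp add: matrix_matrix_mult_def diag_op_def if_distrib[of "\<lambda>x. x * _"] cong: if_cong)

lemma mult_diag_op_nth: "(A ** diag_op f) $ i $ j = A $ i $ j * of_real (f j)"
  by (simp add: matrix_matrix_mult_def diag_op_def if_distrib[of "\<lambda>x. _ * x"] cong: if_cong)

lemma mat_1_eq_diag_op: "mat 1 = diag_op (\<lambda>_. 1)"
  by (simp add: vec_eq_iff mat_def diag_op_def)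

lemma tensor_diag_op:
  "tensor (diag_op f) (diag_op g) = diag_op (\<lambda>i. f (fst i) * g (snd i))"
  by (auto simp: vec_eq_iff tensor_def diag_op_def prod_eq_iff)

lemma dagger_diag_op: "dagger (diag_op f) = diag_op f"
  by (simp add: vec_eq_iff dagger_def diag_op_def)

lemma positive_diag_op:
  assumes "\<And>i. f i \<ge> 0"
  shows "positive_op (diag_op f)"
  unfolding positive_op_def
proof (intro conjI allI)
  show "dagger (diag_op f) = diag_op f" by (rule dagger_diag_op)
  fix v :: "complex^'a"
  have "(diag_op f *v v) $ i = of_real (f i) * v $ i" for i
    by (simp add: matrix_vector_mult_def diag_op_def if_distrib[of "\<lambda>x. x * _"] cong: if_cong)
  then have "Re (cnj (v $ i) * (diag_op f *v v) $ i) = f i * ((Re (v $ i))\<^sup>2 + (Im (v $ i))\<^sup>2)" for i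
    by (simp add: power2_eq_square algebra_simps)
  then show "0 \<le> Re (\<Sum>i\<in>UNIV. cnj (v $ i) * (diag_op f *v v) $ i)"
    using assms by (simp add: sum_nonneg)
qed

text \<open>The diagonal of square roots witnesses that the choice in \<open>op_sqrt\<close> has a
  candidate; the chosen operator then has the right square by its defining property.\<close>

lemma op_sqrt_diag_op_square:
  assumes "\<And>i. f i \<ge> 0"
  shows "op_sqrt (diag_op f) ** op_sqrt (diag_op f) = diag_op f"
proof -
  have "diag_op (\<lambda>i. sqrt (f i)) ** diag_op (\<lambda>i. sqrt (f i)) = diag_op f"
    using assms
    by (auto simp: vec_eq_iff diag_op_mult_nth diag_op_nth simp flip: of_real_mult)
  moreover have "positive_op (diag_op (\<lambda>i. sqrt (f i)))"
    by (rule positive_diag_op) (simp add: assms)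
  ultimately have "\<exists>R. positive_op R \<and> R ** R = diag_op f" by blast
  from someI_ex[OF this] show ?thesis
    unfolding op_sqrt_def by blast
qed

section \<open>The partial trace over the measured qubits\<close>

text \<open>Inserts the measured labels \<open>q = (b, c)\<close> between outer labels
  \<open>a\<close> and \<open>d\<close>. At fixed outer labels, \<open>on_bc X\<close> is ordinary
  multiplication by \<open>X\<close> in \<open>q\<close>.\<close>

definition place_bc :: "mode_pair \<Rightarrow> mode_pair \<Rightarrow> four_modes \<Rightarrow> four_modes \<times> four_modes" where
  "place_bc a d q = ((a, fst q), (snd q, d))"

text \<open>Entries of \<open>on_bc X\<close> vanish unless the outer labels agree, so the
  eight-mode sum in a product with \<open>on_bc X\<close> collapses to one over the measured
  pair.\<close>

lemma sum_place_bc: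
  assumes "\<And>i. fst (fst i) \<noteq> a \<or> snd (snd i) \<noteq> d \<Longrightarrow> f i = 0"
  shows "(\<Sum>i\<in>UNIV. f i) = (\<Sum>q\<in>UNIV. f (place_bc a d q))"
proof -
  have "inj (place_bc a d)"
    by (auto simp: inj_def place_bc_def prod_eq_iff)
  then have "(\<Sum>q\<in>UNIV. f (place_bc a d q)) = (\<Sum>i\<in>range (place_bc a d). f i)"
    by (simp add: sum.reindex)
  also have "\<dots> = (\<Sum>i\<in>UNIV. f i)"
  proof (rule sum.mono_neutral_left; clarsimp)
    fix x1 x2 y1 y2 assume "((x1, x2), (y1, y2)) \<notin> range (place_bc a d)"
    moreover have "((a, x2), (y1, d)) = place_bc a d (x2, y1)"
      by (simp add: place_bc_def)
    ultimately have "x1 \<noteq> a \<or> y2 \<noteq> d"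
      by (metis rangeI)
    then show "f ((x1, x2), (y1, y2)) = 0" using assms by auto
  qed
  finally show ?thesis by simp
qed

lemma on_bc_nth:
  "on_bc X $ i $ j = (if fst (fst i) = fst (fst j) \<and> snd (snd i) = snd (snd j)
     then X $ (snd (fst i), fst (snd i)) $ (snd (fst j), fst (snd j)) else 0)"
  by (simp add: on_bc_def split: prod.splits)

lemma on_bc_place: "on_bc X $ place_bc a d p $ place_bc a d q = X $ p $ q"
  by (simp add: on_bc_nth place_bc_def)

lemma on_bc_mult_nth:
  "(on_bc X ** Y) $ place_bc a d p $ j = (\<Sum>q\<in>UNIV. X $ p $ q * Y $ place_bc a d q $ j)"
proof -
  have "(on_bc X ** Y) $ place_bc a d p $ j
      = (\<Sum>q\<in>UNIV. on_bc X $ place_bc a d p $ place_bc a d q * Y $ place_bc a d q $ j)"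
    unfolding matrix_matrix_mult_def vec_lambda_beta
    by (rule sum_place_bc) (auto simp: on_bc_nth place_bc_def)
  then show ?thesis by (simp add: on_bc_place)
qed

lemma mult_on_bc_nth:
  "(Y ** on_bc X) $ i $ place_bc a d p = (\<Sum>q\<in>UNIV. Y $ i $ place_bc a d q * X $ q $ p)"
proof -
  have "(Y ** on_bc X) $ i $ place_bc a d p
      = (\<Sum>q\<in>UNIV. Y $ i $ place_bc a d q * on_bc X $ place_bc a d q $ place_bc a d p)"
    unfolding matrix_matrix_mult_def vec_lambda_beta
    by (rule sum_place_bc) (auto simp: on_bc_nth place_bc_def)
  then show ?thesis by (simp add: on_bc_place)
qed

lemma on_bc_mult: "on_bc X ** on_bc Y = on_bc (X ** Y)"
proof -
  have "(on_bc X ** on_bc Y) $ i $ j = on_bc (X ** Y) $ i $ j" for i j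
  proof -
    have i: "i = place_bc (fst (fst i)) (snd (snd i)) (snd (fst i), fst (snd i))"
      by (simp add: place_bc_def)
    show ?thesis
      by (subst i, subst on_bc_mult_nth)
        (auto simp: on_bc_nth matrix_matrix_mult_def place_bc_def intro!: sum.neutral)
  qed
  then show ?thesis by (simp add: vec_eq_iff)
qed

lemma dagger_on_bc: "dagger (on_bc X) = on_bc (dagger X)"
  by (auto simp: vec_eq_iff dagger_def on_bc_nth)

lemma trace_bc_nth:
  "trace_bc R $ i $ j = (\<Sum>q\<in>UNIV. R $ place_bc (fst i) (snd i) q $ place_bc (fst j) (snd j) q)"
  by (simp add: trace_bc_def place_bc_def sum.cartesian_product case_prod_beta)

text \<open>A partial trace is not cyclic in general, but it is for a factor acting only on the
  traced systems: both sides are the same double sum over measured labels.\<close>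

lemma trace_bc_cyclic: "trace_bc (on_bc X ** Y) = trace_bc (Y ** on_bc X)"
proof -
  have "trace_bc (on_bc X ** Y) $ i $ j = trace_bc (Y ** on_bc X) $ i $ j" for i j
    unfolding trace_bc_nth on_bc_mult_nth mult_on_bc_nth
    by (subst sum.swap) (simp add: mult.commute)
  then show ?thesis by (simp add: vec_eq_iff)
qed

lemma trace_trace_bc: "trace (trace_bc R) = trace R"
proof -
  have "bij (\<lambda>(x, q). place_bc (fst x) (snd x) q)"
    by (rule o_bij[where g = "\<lambda>i. ((fst (fst i), snd (snd i)), (snd (fst i), fst (snd i)))"])
      (auto simp: place_bc_def fun_eq_iff)
  then have "(\<Sum>i\<in>UNIV. R $ i $ i)
      = (\<Sum>z\<in>UNIV. R $ (case z of (x, q) \<Rightarrow> place_bc (fst x) (snd x) q) $ (case z of (x, q) \<Rightarrow> place_bc (fst x) (snd x) q))"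
    by (intro sum.reindex_bij_betw[symmetric])
  then show ?thesis
    by (simp add: trace_def trace_bc_nth sum.cartesian_product case_prod_beta)
qed

text \<open>The unnormalised state of \<open>ad\<close> after outcome \<open>E\<close>, in the
  Heisenberg picture: the beamsplitter is moved from the state to the measurement operator.\<close>

definition conditional_op :: "four_mode_op \<Rightarrow> four_mode_op \<Rightarrow> four_mode_op \<Rightarrow> four_mode_op" where
  "conditional_op E \<sigma> \<tau> = trace_bc (on_bc (dagger beamsplitter ** E ** beamsplitter) ** tensor \<sigma> \<tau>)"

text \<open>By cyclicity the state after the measurement depends on the square root \<open>R\<close> of \<open>E\<close> only through
  \<open>R ** R\<close>, so that an arbitrary choice of \<open>R\<close> does.\<close>

lemma trace_bc_sandwich:
  assumes "R ** R = E"
  shows "trace_bc (on_bc R ** after_beamsplitter \<sigma> \<tau> ** on_bc R) = conditional_op E \<sigma> \<tau>"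
    and "trace_bc (on_bc E ** after_beamsplitter \<sigma> \<tau>) = conditional_op E \<sigma> \<tau>"
proof -
  have *: "trace_bc (on_bc E ** after_beamsplitter \<sigma> \<tau>) = conditional_op E \<sigma> \<tau>" for E
  proof -
    have "trace_bc (on_bc E ** after_beamsplitter \<sigma> \<tau>)
        = trace_bc ((on_bc E ** on_bc beamsplitter ** tensor \<sigma> \<tau>) ** on_bc (dagger beamsplitter))"
      by (simp add: after_beamsplitter_def dagger_on_bc matrix_mul_assoc)
    also have "\<dots> = conditional_op E \<sigma> \<tau>"
      unfolding conditional_op_def trace_bc_cyclic[symmetric]
      by (simp add: on_bc_mult matrix_mul_assoc)
    finally show ?thesis .
  qed
  show "trace_bc (on_bc E ** after_beamsplitter \<sigma> \<tau>) = conditional_op E \<sigma> \<tau>" by (rule *)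
  have "trace_bc (on_bc R ** after_beamsplitter \<sigma> \<tau> ** on_bc R)
      = trace_bc (on_bc R ** (on_bc R ** after_beamsplitter \<sigma> \<tau>))"
    by (rule trace_bc_cyclic[symmetric])
  then show "trace_bc (on_bc R ** after_beamsplitter \<sigma> \<tau> ** on_bc R) = conditional_op E \<sigma> \<tau>"
    using assms by (simp add: matrix_mul_assoc on_bc_mult *)
qed

lemma conditional_op_nth:
  "conditional_op E \<sigma> \<tau> $ (a, d) $ (a', d') =
    (\<Sum>(b, c)\<in>UNIV. \<Sum>(b', c')\<in>UNIV. (dagger beamsplitter ** E ** beamsplitter) $ (b, c) $ (b', c')
       * (\<sigma> $ (a, b') $ (a', b) * \<tau> $ (c', d) $ (c, d')))"
  unfolding conditional_op_def trace_bc_nth on_bc_mult_nth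
  by (simp add: tensor_def place_bc_def case_prod_beta)

section \<open>Detectors and beamsplitter on number states\<close>

definition click_prob :: "real \<Rightarrow> real \<Rightarrow> nat \<Rightarrow> occupation \<Rightarrow> real" where
  "click_prob P \<eta> j i =
     (if j = 0 then (1 - P) * (1 - \<eta>) ^ photons i else 1 - (1 - P) * (1 - \<eta>) ^ photons i)"

lemma detector_eq_diag_op: "detector P \<eta> j = diag_op (click_prob P \<eta> j)"
proof -
  have "detector P \<eta> j $ i $ i' = diag_op (click_prob P \<eta> j) $ i $ i'" for i i'
    by (cases i)
      (auto simp: detector_def no_click_def proj_photons_def mat_def diag_op_def click_prob_def
         scaleR_conv_of_real[where 'a = complex])
  then show ?thesis by (simp add: vec_eq_iff)
qed

lemma click_prob_nonneg:
  assumes "P \<in> {0..1}" "\<eta> \<in> {0..1}"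
  shows "click_prob P \<eta> j i \<ge> 0"
proof -
  have "(1 - P) * (1 - \<eta>) ^ photons i \<in> {0..1}"
    using assms by (simp add: mult_le_one power_le_one)
  then show ?thesis by (simp add: click_prob_def)
qed

definition click_pattern_prob ::
  "real \<Rightarrow> real \<Rightarrow> nat \<Rightarrow> nat \<Rightarrow> nat \<Rightarrow> nat \<Rightarrow> four_modes \<Rightarrow> real" where
  "click_pattern_prob P \<eta> j k l m x =
     click_prob P \<eta> j (fst (fst x)) * click_prob P \<eta> k (snd (fst x))
     * (click_prob P \<eta> l (fst (snd x)) * click_prob P \<eta> m (snd (snd x)))"

lemma four_detectors_eq_diag_op:
  "four_detectors P \<eta> j k l m = diag_op (click_pattern_prob P \<eta> j k l m)"
  by (simp add: four_detectors_def detector_eq_diag_op tensor_diag_op click_pattern_prob_def[abs_def])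

lemma op_sqrt_bsm_element_square:
  assumes "P \<in> {0..1}" "\<eta> \<in> {0..1}"
  shows "op_sqrt (bsm_element P \<eta> S) ** op_sqrt (bsm_element P \<eta> S) = bsm_element P \<eta> S"
  unfolding bsm_element_def four_detectors_eq_diag_op
  by (rule op_sqrt_diag_op_square)
    (simp add: click_pattern_prob_def click_prob_nonneg[OF assms])

section \<open>Beamsplitter amplitudes for one photon in each input qubit\<close>

abbreviation number_state ::
  "occupation \<Rightarrow> occupation \<Rightarrow> occupation \<Rightarrow> occupation \<Rightarrow> complex^four_modes" where
  "number_state i j k l \<equiv> axis ((i, j), (k, l)) 1"

lemma matrix_vector_mult_axis: "(A :: complex^'n::finite^'m) *v axis k 1 = (\<chi> i. A $ i $ k)"
  by (simp add: vec_eq_iff matrix_vector_mult_def axis_def if_distrib[of "\<lambda>x. _ * x"] cong: if_cong)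

lemma scaleR_mult_vec:
  fixes A :: "complex^'n::finite^'m"
  shows "(r *\<^sub>R A) *v v = r *\<^sub>R (A *v v)" "A *v (r *\<^sub>R v) = r *\<^sub>R (A *v v)"
  by (simp_all add: vec_eq_iff matrix_vector_mult_def scaleR_sum_right)

lemma creation_nth:
  "creation $ x $ y = (if x = One \<and> y = Zero then 1 else if x = Two \<and> y = One then of_real (sqrt 2) else 0)"
  by (cases x; cases y) (simp_all add: creation_def)

text \<open>Only \<open>Zero\<close> and \<open>One\<close> are raised: raising \<open>Two\<close>
  would meet the cutoff, which cannot happen while a two-photon state is built from the
  vacuum.\<close>

lemma create_number_state:
  "create_b1 *v number_state Zero j k l = number_state One j k l"
  "create_b1 *v number_state One j k l = sqrt 2 *\<^sub>R number_state Two j k l"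
  "create_b2 *v number_state i Zero k l = number_state i One k l"
  "create_b2 *v number_state i One k l = sqrt 2 *\<^sub>R number_state i Two k l"
  "create_c1 *v number_state i j Zero l = number_state i j One l"
  "create_c1 *v number_state i j One l = sqrt 2 *\<^sub>R number_state i j Two l"
  "create_c2 *v number_state i j k Zero = number_state i j k One"
  "create_c2 *v number_state i j k One = sqrt 2 *\<^sub>R number_state i j k Two"
  unfolding matrix_vector_mult_axis create_b1_def create_b2_def create_c1_def create_c2_def
  by (auto simp: vec_eq_iff tensor_def mat_def creation_nth axis_def scaleR_conv_of_real[where 'a = complex])

lemmas expand_beamsplitter =
  Let_def vacuum_def create_number_state scaleR_mult_vec
  matrix_vector_mult_add_rdistrib matrix_vector_mult_diff_rdistrib
  matrix_vector_right_distrib matrix_vector_mult_diff_distrib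

text \<open>For like modes the cross terms of \<open>(b + c) (b - c)\<close> cancel
  (Hong-Ou-Mandel), and the factor \<open>sqrt 2\<close> from filling a mode twice turns
  \<open>1 / 2\<close> into \<open>1 / sqrt 2\<close>.\<close>

lemma beamsplitter_column:
  "(\<chi> m. beamsplitter $ m $ (q10, q10)) = (1 / sqrt 2) *\<^sub>R (number_state Two Zero Zero Zero - number_state Zero Zero Two Zero)"
  "(\<chi> m. beamsplitter $ m $ (q01, q01)) = (1 / sqrt 2) *\<^sub>R (number_state Zero Two Zero Zero - number_state Zero Zero Zero Two)"
  "(\<chi> m. beamsplitter $ m $ (q10, q01)) = (1 / 2) *\<^sub>R (number_state One One Zero Zero
     - number_state One Zero Zero One + number_state Zero One One Zero - number_state Zero Zero One One)"
  "(\<chi> m. beamsplitter $ m $ (q01, q10)) = (1 / 2) *\<^sub>R (number_state One One Zero Zero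
     + number_state One Zero Zero One - number_state Zero One One Zero - number_state Zero Zero One One)"
  by (simp_all add: beamsplitter_def expand_beamsplitter) (simp_all add: vec_eq_iff algebra_simps)

lemmas beamsplitter_nth = beamsplitter_column[unfolded vec_eq_iff vec_lambda_beta, rule_format]

text \<open>Weights \<open>p\<close> on \<open>\<psi>\<^sub>1, \<psi>\<^sub>2\<close> and \<open>r\<close> on \<open>\<psi>\<^sub>0, \<psi>\<^sub>3\<close>, with coherence \<open>k\<close> between \<open>\<psi>\<^sub>1\<close> and
  \<open>\<psi>\<^sub>2\<close>; that is, weight \<open>p \<plusminus> k\<close> on \<open>M\<^sup>\<plusminus>\<close>. Both the states of the chain and the pulled-back
  measurement operators have this form.\<close>

definition bell_form :: "real \<Rightarrow> real \<Rightarrow> real \<Rightarrow> four_mode_op" where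
  "bell_form p r k = (\<chi> i j. of_real
     (if i = j then (if i \<in> {(q10, q01), (q01, q10)} then p else if i \<in> {(q10, q10), (q01, q01)} then r else 0)
      else if (i, j) \<in> {((q10, q01), (q01, q10)), ((q01, q10), (q10, q01))} then k else 0))"

lemma pure_M_plus: "pure_state M_plus = bell_form (1/2) 0 (1/2)"
proof -
  have *: "complex_of_real (sqrt 2) * complex_of_real (sqrt 2) = 2"
    by (simp flip: of_real_mult)
  show ?thesis
    by (auto simp: vec_eq_iff pure_state_def M_plus_def bell_form_def axis_def
        scaleR_conv_of_real[where 'a = complex] *)
qed

text \<open>The four columns meet only in the \<open>M\<^sup>\<plusminus>\<close> block: \<open>M\<^sup>+\<close> bunches both photons on one side of the
  beamsplitter, \<open>M\<^sup>-\<close> splits them, and two photons in like modes end up together in one mode.\<close>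

lemma beamsplitter_sandwich_nth:
  assumes x: "x \<in> {q10, q01} \<times> {q10, q01}" and y: "y \<in> {q10, q01} \<times> {q10, q01}"
    and e: "e ((Two, Zero), (Zero, Zero)) + e ((Zero, Zero), (Two, Zero)) = 2 * h"
      "e ((Zero, Two), (Zero, Zero)) + e ((Zero, Zero), (Zero, Two)) = 2 * h"
      "e ((One, One), (Zero, Zero)) + e ((Zero, Zero), (One, One)) = 2 * (g + l)"
      "e ((One, Zero), (Zero, One)) + e ((Zero, One), (One, Zero)) = 2 * (g - l)"
  shows "(dagger beamsplitter ** diag_op e ** beamsplitter) $ x $ y = bell_form g h l $ x $ y"
proof -
  define u :: "four_modes \<Rightarrow> four_modes \<Rightarrow> complex" where "u = (\<lambda>k m. beamsplitter $ m $ k)"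
  \<comment> \<open>The union of the supports of the four columns.\<close>
  define T :: "four_modes set" where "T = {((Two, Zero), (Zero, Zero)), ((Zero, Zero), (Two, Zero)),
    ((Zero, Two), (Zero, Zero)), ((Zero, Zero), (Zero, Two)), ((One, One), (Zero, Zero)),
    ((Zero, Zero), (One, One)), ((One, Zero), (Zero, One)), ((Zero, One), (One, Zero))}"
  have "(dagger beamsplitter ** diag_op e ** beamsplitter) $ x $ y
      = (\<Sum>m\<in>UNIV. cnj (u x m) * of_real (e m) * u y m)"
    by (subst matrix_matrix_mult_def) (simp add: mult_diag_op_nth dagger_def u_def)
  also have "\<dots> = (\<Sum>m\<in>T. cnj (u x m) * of_real (e m) * u y m)"
  proof (rule sum.mono_neutral_right)
    have "u y m = 0" if "m \<notin> T" for m
      using y that by (auto simp: u_def beamsplitter_nth axis_def T_def)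
    then show "\<forall>m\<in>UNIV - T. cnj (u x m) * of_real (e m) * u y m = 0" by simp
  qed auto
  also have "\<dots> = bell_form g h l $ x $ y"
  proof -
    have r: "complex_of_real (sqrt 2) * complex_of_real (sqrt 2) = 2"
      by (simp flip: of_real_mult)
    \<comment> \<open>Within each pair the amplitudes have equal modulus, so \<open>e\<close> enters
      only through pair sums; eliminating one member of each pair exposes this to the
      arithmetic.\<close>
    have e': "e ((Two, Zero), (Zero, Zero)) = 2 * h - e ((Zero, Zero), (Two, Zero))"
      "e ((Zero, Two), (Zero, Zero)) = 2 * h - e ((Zero, Zero), (Zero, Two))"
      "e ((One, One), (Zero, Zero)) = 2 * (g + l) - e ((Zero, Zero), (One, One))"
      "e ((One, Zero), (Zero, One)) = 2 * (g - l) - e ((Zero, One), (One, Zero))"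
      using e by auto
    have T: "(\<Sum>m\<in>T. f m) = f ((Two, Zero), (Zero, Zero)) + f ((Zero, Zero), (Two, Zero))
      + f ((Zero, Two), (Zero, Zero)) + f ((Zero, Zero), (Zero, Two)) + f ((One, One), (Zero, Zero))
      + f ((Zero, Zero), (One, One)) + f ((One, Zero), (Zero, One)) + f ((Zero, One), (One, Zero))"
      for f :: "four_modes \<Rightarrow> complex"
      by (simp add: T_def)
    from x y have "x \<in> {(q10, q10), (q10, q01), (q01, q10), (q01, q01)}"
      "y \<in> {(q10, q10), (q10, q01), (q01, q10), (q01, q01)}"
      by auto
    then show ?thesis
      unfolding T insert_iff empty_iff
      by (elim disjE FalseE; simp add: u_def beamsplitter_nth axis_def bell_form_def
          scaleR_conv_of_real[where 'a = complex] e')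
        (simp_all add: r field_simps)
  qed
  finally show ?thesis .
qed

section \<open>Swapping states of Bell form\<close>

lemma sum_qubit_pairs:
  fixes f :: "four_modes \<Rightarrow> 'a::comm_monoid_add"
  assumes "\<And>x. x \<notin> {q10, q01} \<times> {q10, q01} \<Longrightarrow> f x = 0"
  shows "(\<Sum>x\<in>UNIV. f x) = f (q10, q10) + f (q10, q01) + f (q01, q10) + f (q01, q01)"
proof -
  have "(\<Sum>x\<in>UNIV. f x) = (\<Sum>x\<in>{q10, q01} \<times> {q10, q01}. f x)"
    by (rule sum.mono_neutral_right) (use assms in auto)
  also have "\<dots> = (\<Sum>x\<in>{(q10, q10), (q10, q01), (q01, q10), (q01, q01)}. f x)"
    by (rule sum.cong) auto
  finally show ?thesis by (simp add: add.assoc)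
qed

lemma bell_form_nth_eq_0:
  assumes "i \<notin> {q10, q01} \<times> {q10, q01} \<or> j \<notin> {q10, q01} \<times> {q10, q01}"
  shows "bell_form p r k $ i $ j = 0"
  using assms by (auto simp: bell_form_def)

text \<open>A diagonal operator sees only populations, so the coherence \<open>k\<close> drops out.
  This serves both the normalisation and the final detection.\<close>

lemma trace_bell_form_mult_diag_op:
  "trace (bell_form p r k ** diag_op f) =
    of_real (r * (f (q10, q10) + f (q01, q01)) + p * (f (q10, q01) + f (q01, q10)))"
  unfolding trace_def mult_diag_op_nth
  by (subst sum_qubit_pairs) (simp only: bell_form_nth_eq_0 simp_thms mult_zero_left,
    simp add: bell_form_def algebra_simps)

lemma trace_bell_form: "trace (bell_form p r k) = of_real (2 * p + 2 * r)"
  using trace_bell_form_mult_diag_op[of p r k "\<lambda>_. 1"]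
  by (simp add: mat_1_eq_diag_op[symmetric] algebra_simps)

lemma scaleR_bell_form: "t *\<^sub>R bell_form p r k = bell_form (t * p) (t * r) (t * k)"
proof -
  have "(t *\<^sub>R bell_form p r k) $ i $ j = bell_form (t * p) (t * r) (t * k) $ i $ j" for i j
    by (simp add: bell_form_def scaleR_conv_of_real[where 'a = complex])
  then show ?thesis by (simp add: vec_eq_iff)
qed

text \<open>The two states joined by the coherence differ in the second qubit, so conjugation gives
  the coherence one sign and each population the square of a sign.\<close>

lemma phase_flip_bell_form:
  "phase_flip_d ** bell_form p r k ** dagger phase_flip_d = bell_form p r (- k)"
proof -
  define f :: "four_modes \<Rightarrow> real" where "f = (\<lambda>i. if snd i = q01 then -1 else 1)"
  have "(\<chi> i j. if i = j then (if i = q01 then -1 else 1) else 0) = diag_op (\<lambda>i. if i = q01 then -1 else 1)"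
    by (simp add: vec_eq_iff diag_op_def)
  then have flip: "phase_flip_d = diag_op f"
    by (simp add: phase_flip_d_def mat_1_eq_diag_op tensor_diag_op f_def)
  have nth: "(phase_flip_d ** bell_form p r k ** dagger phase_flip_d) $ i $ j
      = of_real (f i * f j) * bell_form p r k $ i $ j" for i j
    unfolding flip dagger_diag_op mult_diag_op_nth diag_op_mult_nth by simp
  have "of_real (f i * f j) * bell_form p r k $ i $ j = bell_form p r (- k) $ i $ j" for i j
  proof (cases "i = j")
    case True
    then show ?thesis by (simp add: bell_form_def f_def)
  next
    case False
    show ?thesis
    proof (cases "(i, j) \<in> {((q10, q01), (q01, q10)), ((q01, q10), (q10, q01))}")
      case True
      then have "f i * f j = -1" by (auto simp: f_def)
      with True False show ?thesis by (simp add: bell_form_def)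
    next
      case outside: False
      with \<open>i \<noteq> j\<close> show ?thesis
        by (simp only: bell_form_def vec_lambda_beta if_False simp_thms of_real_0 mult_zero_right)
    qed
  qed
  with nth show ?thesis by (simp add: vec_eq_iff)
qed

text \<open>Parity count: qubits \<open>a\<close> and \<open>d\<close> are opposite iff an odd
  number of the pairs \<open>ab\<close>, \<open>bc\<close>, \<open>cd\<close> are, with weights
  \<open>p\<close>, \<open>g\<close>, \<open>p'\<close> for opposite and \<open>r\<close>,
  \<open>h\<close>, \<open>r'\<close> for equal. The three coherences simply multiply.\<close>

lemma conditional_op_bell_form:
  assumes "\<And>x y. x \<in> {q10, q01} \<times> {q10, q01} \<Longrightarrow> y \<in> {q10, q01} \<times> {q10, q01} \<Longrightarrow>
    (dagger beamsplitter ** E ** beamsplitter) $ x $ y = bell_form g h l $ x $ y"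
  shows "conditional_op E (bell_form p r k) (bell_form p' r' k') =
    bell_form (g * (p * p' + r * r') + h * (p * r' + r * p'))
      (h * (p * p' + r * r') + g * (p * r' + r * p')) (l * k * k')"
proof -
  let ?\<sigma> = "bell_form p r k" and ?\<tau> = "bell_form p' r' k'" and ?G = "bell_form g h l"
  let ?Q = "{q10, q01} \<times> {q10, q01}"
  \<comment> \<open>Outside the qubit space one of the two states has a vanishing entry, so knowing
    the pulled-back \<open>E\<close> on qubit labels suffices.\<close>
  have *: "conditional_op E ?\<sigma> ?\<tau> $ (a, d) $ (a', d') =
    (\<Sum>(b, c)\<in>UNIV. \<Sum>(b', c')\<in>UNIV. ?G $ (b, c) $ (b', c')
       * (?\<sigma> $ (a, b') $ (a', b) * ?\<tau> $ (c', d) $ (c, d')))" for a d a' d'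
    unfolding conditional_op_nth
  proof (intro sum.cong refl, clarify, intro sum.cong refl, clarify)
    fix b1 b2 c1 c2 b1' b2' c1' c2' :: occupation
    let ?b = "(b1, b2)" and ?c = "(c1, c2)" and ?b' = "(b1', b2')" and ?c' = "(c1', c2')"
    show "(dagger beamsplitter ** E ** beamsplitter) $ (?b, ?c) $ (?b', ?c')
          * (?\<sigma> $ (a, ?b') $ (a', ?b) * ?\<tau> $ (?c', d) $ (?c, d'))
        = ?G $ (?b, ?c) $ (?b', ?c') * (?\<sigma> $ (a, ?b') $ (a', ?b) * ?\<tau> $ (?c', d) $ (?c, d'))"
    proof (cases "(?b, ?c) \<in> ?Q \<and> (?b', ?c') \<in> ?Q")
      case True
      then show ?thesis using assms by metis
    next
      case False
      then have "?\<sigma> $ (a, ?b') $ (a', ?b) = 0 \<or> ?\<tau> $ (?c', d) $ (?c, d') = 0"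
        by (metis SigmaD2 SigmaI SigmaD1 bell_form_nth_eq_0)
      then show ?thesis by auto
    qed
  qed
  have "conditional_op E ?\<sigma> ?\<tau> $ (a, d) $ (a', d') =
    bell_form (g * (p * p' + r * r') + h * (p * r' + r * p'))
      (h * (p * p' + r * r') + g * (p * r' + r * p')) (l * k * k') $ (a, d) $ (a', d')" for a d a' d'
  proof -
    let ?F = "\<lambda>x y. ?G $ x $ y * (?\<sigma> $ (a, fst y) $ (a', fst x) * ?\<tau> $ (snd y, d) $ (snd x, d'))"
    have s: "conditional_op E ?\<sigma> ?\<tau> $ (a, d) $ (a', d') = (\<Sum>x\<in>UNIV. \<Sum>y\<in>UNIV. ?F x y)"
      by (simp add: * case_prod_beta)
    show ?thesis
    proof (cases "(a, d) \<in> ?Q \<and> (a', d') \<in> ?Q")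
      case False
      then have "?\<sigma> $ (a, b') $ (a', b) = 0 \<or> ?\<tau> $ (c', d) $ (c, d') = 0" for b b' c c'
        by (metis SigmaD1 SigmaD2 SigmaI bell_form_nth_eq_0)
      then have "?F x y = 0" for x y by (metis mult_eq_0_iff)
      then show ?thesis using False by (simp only: s bell_form_nth_eq_0 de_Morgan_conj sum.neutral_const)
    next
      case True
      have inner: "(\<Sum>y\<in>UNIV. ?F x y)
          = ?F x (q10, q10) + ?F x (q10, q01) + ?F x (q01, q10) + ?F x (q01, q01)" for x
        by (rule sum_qubit_pairs) (simp only: bell_form_nth_eq_0 simp_thms mult_zero_left)
      have outer: "conditional_op E ?\<sigma> ?\<tau> $ (a, d) $ (a', d') =
          (\<Sum>y\<in>UNIV. ?F (q10, q10) y) + (\<Sum>y\<in>UNIV. ?F (q10, q01) y)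
          + (\<Sum>y\<in>UNIV. ?F (q01, q10) y) + (\<Sum>y\<in>UNIV. ?F (q01, q01) y)"
        unfolding s
        by (rule sum_qubit_pairs) (simp only: bell_form_nth_eq_0 simp_thms mult_zero_left sum.neutral_const)
      from True have "a \<in> {q10, q01}" "d \<in> {q10, q01}" "a' \<in> {q10, q01}" "d' \<in> {q10, q01}"
        by auto
      then show ?thesis
        unfolding outer inner insert_iff empty_iff
        by (elim disjE FalseE; simp add: bell_form_def) (simp_all add: algebra_simps)
    qed
  qed
  then show ?thesis by (simp add: vec_eq_iff)
qed

section \<open>Coefficients of a successful outcome and of the swap map\<close>

definition bsm_A :: "real \<Rightarrow> real \<Rightarrow> real" where
  "bsm_A P \<eta> = \<eta> + P * (1 - \<eta>)"
definition bsm_B :: "real \<Rightarrow> real \<Rightarrow> real" where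
  "bsm_B P \<eta> = 1 - (1 - P) * (1 - \<eta>)^2"
definition bsm_a :: "real \<Rightarrow> real \<Rightarrow> real" where
  "bsm_a P \<eta> = 1/8 * (P^2 * (1 - bsm_A P \<eta>)^2 + (bsm_A P \<eta>)^2 * (1 - P)^2)"
definition bsm_b :: "real \<Rightarrow> real \<Rightarrow> real" where
  "bsm_b P \<eta> = 1/8 * (2 * bsm_A P \<eta> * P * (1 - bsm_A P \<eta>) * (1 - P))"
definition bsm_c :: "real \<Rightarrow> real \<Rightarrow> real" where
  "bsm_c P \<eta> = 1/8 * P * (1 - P) * (P * (1 - bsm_B P \<eta>) + bsm_B P \<eta> * (1 - P))"
definition bsm_s :: "real \<Rightarrow> real \<Rightarrow> real" where
  "bsm_s P \<eta> = bsm_a P \<eta> + bsm_b P \<eta> + 2 * bsm_c P \<eta>"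

lemma click_prob_simps:
  "click_prob P \<eta> 0 Zero = 1 - P" "click_prob P \<eta> (Suc 0) Zero = P"
  "click_prob P \<eta> 0 One = 1 - bsm_A P \<eta>" "click_prob P \<eta> (Suc 0) One = bsm_A P \<eta>"
  "click_prob P \<eta> 0 Two = 1 - bsm_B P \<eta>" "click_prob P \<eta> (Suc 0) Two = bsm_B P \<eta>"
  by (simp_all add: click_prob_def bsm_A_def bsm_B_def algebra_simps)

text \<open>Splitting outcomes herald \<open>M\<^sup>-\<close>, which only flips the sign of the coherence.\<close>

definition herald_sign :: "nat set \<Rightarrow> real" where
  "herald_sign S = (if S \<in> {{1, 4}, {2, 3}} then -1 else 1)"

text \<open>Two photons on distinct detectors fire the pattern with no or two dark clicks (these
  terms add to \<open>8 a\<close>) or with one (\<open>8 b\<close>); two photons in one mode give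
  \<open>8 c\<close>. Splitting outcomes exchange the first two cases between bunched and split
  photons.\<close>

lemma bsm_element_sandwich_nth:
  assumes S: "S \<in> bsm_successes"
    and xy: "x \<in> {q10, q01} \<times> {q10, q01}" "y \<in> {q10, q01} \<times> {q10, q01}"
  shows "(dagger beamsplitter ** bsm_element P \<eta> S ** beamsplitter) $ x $ y =
    bell_form (2 * (bsm_a P \<eta> + bsm_b P \<eta>)) (4 * bsm_c P \<eta>)
      (herald_sign S * 2 * (bsm_a P \<eta> - bsm_b P \<eta>)) $ x $ y"
proof -
  \<comment> \<open>Matching the goal fixes \<open>g + l\<close> and \<open>g - l\<close> as
    \<open>4 a\<close> and \<open>4 b\<close>, in this order for bunching outcomes and reversed for
    splitting ones.\<close>
  have e: "(dagger beamsplitter ** bsm_element P \<eta> S ** beamsplitter) $ x $ y = bell_form g h l $ x $ y"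
    if "bsm_element P \<eta> S = diag_op (click_pattern_prob P \<eta> i j k m)"
      "click_pattern_prob P \<eta> i j k m ((Two, Zero), (Zero, Zero)) + click_pattern_prob P \<eta> i j k m ((Zero, Zero), (Two, Zero)) = 2 * h"
      "click_pattern_prob P \<eta> i j k m ((Zero, Two), (Zero, Zero)) + click_pattern_prob P \<eta> i j k m ((Zero, Zero), (Zero, Two)) = 2 * h"
      "click_pattern_prob P \<eta> i j k m ((One, One), (Zero, Zero)) + click_pattern_prob P \<eta> i j k m ((Zero, Zero), (One, One)) = 2 * (g + l)"
      "click_pattern_prob P \<eta> i j k m ((One, Zero), (Zero, One)) + click_pattern_prob P \<eta> i j k m ((Zero, One), (One, Zero)) = 2 * (g - l)"
    for i j k m g h l
    unfolding that(1) by (rule beamsplitter_sandwich_nth[OF xy that(2-5)])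
  note simps = click_pattern_prob_def click_prob_simps bsm_a_def bsm_b_def bsm_c_def
    power2_eq_square field_simps
  from S consider "S = {1, 2}" | "S = {3, 4}" | "S = {1, 4}" | "S = {2, 3}"
    by (auto simp: bsm_successes_def)
  then show ?thesis
  proof cases
    case 1
    then have h: "herald_sign S = 1"
      and E: "bsm_element P \<eta> S = diag_op (click_pattern_prob P \<eta> (Suc 0) (Suc 0) 0 0)"
      by (simp_all add: herald_sign_def doubleton_eq_iff bsm_element_def four_detectors_eq_diag_op)
    show ?thesis by (rule e[OF E]) (simp_all add: h simps)
  next
    case 2
    then have h: "herald_sign S = 1"
      and E: "bsm_element P \<eta> S = diag_op (click_pattern_prob P \<eta> 0 0 (Suc 0) (Suc 0))"
      by (simp_all add: herald_sign_def doubleton_eq_iff bsm_element_def four_detectors_eq_diag_op)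
    show ?thesis by (rule e[OF E]) (simp_all add: h simps)
  next
    case 3
    then have h: "herald_sign S = -1"
      and E: "bsm_element P \<eta> S = diag_op (click_pattern_prob P \<eta> (Suc 0) 0 0 (Suc 0))"
      by (simp_all add: herald_sign_def doubleton_eq_iff bsm_element_def four_detectors_eq_diag_op)
    show ?thesis by (rule e[OF E]) (simp_all add: h simps)
  next
    case 4
    then have h: "herald_sign S = -1"
      and E: "bsm_element P \<eta> S = diag_op (click_pattern_prob P \<eta> 0 (Suc 0) (Suc 0) 0)"
      by (simp_all add: herald_sign_def doubleton_eq_iff bsm_element_def four_detectors_eq_diag_op)
    show ?thesis by (rule e[OF E]) (simp_all add: h simps)
  qed
qed

definition swap_p :: "real \<Rightarrow> real \<Rightarrow> real \<Rightarrow> real \<Rightarrow> real" where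
  "swap_p P \<eta> p r = (2 * (bsm_a P \<eta> + bsm_b P \<eta>) * (p^2 + r^2) + 8 * bsm_c P \<eta> * p * r) / bsm_s P \<eta>"
definition swap_r :: "real \<Rightarrow> real \<Rightarrow> real \<Rightarrow> real \<Rightarrow> real" where
  "swap_r P \<eta> p r = (4 * bsm_c P \<eta> * (p^2 + r^2) + 4 * (bsm_a P \<eta> + bsm_b P \<eta>) * p * r) / bsm_s P \<eta>"
definition swap_k :: "real \<Rightarrow> real \<Rightarrow> real \<Rightarrow> real" where
  "swap_k P \<eta> k = 2 * (bsm_a P \<eta> - bsm_b P \<eta>) * k^2 / bsm_s P \<eta>"

text \<open>The output weights sum to \<open>2 s (p + r)^2\<close> before normalisation, so the
  normalisation \<open>p + r = 1 / 2\<close> of the input makes the outcome probability independent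
  of the state.\<close>

lemma bsm_bell_form:
  assumes S: "S \<in> bsm_successes" and P: "P \<in> {0..1}" and \<eta>: "\<eta> \<in> {0..1}"
    and s: "bsm_s P \<eta> \<noteq> 0" and pr: "p + r = 1 / 2"
  shows "bsm_prob P \<eta> (bell_form p r k) (bell_form p r k) S = bsm_s P \<eta>"
    and "heralded_state P \<eta> (bell_form p r k) (bell_form p r k) S =
      bell_form (swap_p P \<eta> p r) (swap_r P \<eta> p r) (swap_k P \<eta> k)"
proof -
  let ?\<sigma> = "bell_form p r k" and ?E = "bsm_element P \<eta> S" and ?s = "bsm_s P \<eta>"
  have swap_mult:
    "?s * swap_p P \<eta> p r = 2 * (bsm_a P \<eta> + bsm_b P \<eta>) * (p^2 + r^2) + 8 * bsm_c P \<eta> * p * r"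
    "?s * swap_r P \<eta> p r = 4 * bsm_c P \<eta> * (p^2 + r^2) + 4 * (bsm_a P \<eta> + bsm_b P \<eta>) * p * r"
    "?s * swap_k P \<eta> k = 2 * (bsm_a P \<eta> - bsm_b P \<eta>) * k^2"
    using s by (simp_all add: swap_p_def swap_r_def swap_k_def)
  have "conditional_op ?E ?\<sigma> ?\<sigma> =
      bell_form (2 * (bsm_a P \<eta> + bsm_b P \<eta>) * (p * p + r * r) + 4 * bsm_c P \<eta> * (p * r + r * p))
        (4 * bsm_c P \<eta> * (p * p + r * r) + 2 * (bsm_a P \<eta> + bsm_b P \<eta>) * (p * r + r * p))
        (herald_sign S * 2 * (bsm_a P \<eta> - bsm_b P \<eta>) * k * k)"
    by (rule conditional_op_bell_form) (rule bsm_element_sandwich_nth[OF S])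
  also have "\<dots> = bell_form (?s * swap_p P \<eta> p r) (?s * swap_r P \<eta> p r) (?s * (herald_sign S * swap_k P \<eta> k))"
    unfolding mult.left_commute[of ?s "herald_sign S"] swap_mult
    by (simp add: power2_eq_square algebra_simps)
  finally have c: "conditional_op ?E ?\<sigma> ?\<sigma> =
      bell_form (?s * swap_p P \<eta> p r) (?s * swap_r P \<eta> p r) (?s * (herald_sign S * swap_k P \<eta> k))" .
  have "?s * swap_p P \<eta> p r + ?s * swap_r P \<eta> p r = 2 * ?s * (p + r)^2"
    unfolding swap_mult by (simp add: bsm_s_def power2_eq_square algebra_simps)
  then have n: "2 * (?s * swap_p P \<eta> p r) + 2 * (?s * swap_r P \<eta> p r) = ?s"
    by (simp add: pr power2_eq_square)
  have prob: "bsm_prob P \<eta> ?\<sigma> ?\<sigma> S = Re (trace (conditional_op ?E ?\<sigma> ?\<sigma>))"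
    unfolding bsm_prob_def trace_trace_bc[symmetric]
      trace_bc_sandwich(2)[OF op_sqrt_bsm_element_square[OF P \<eta>]] ..
  show p: "bsm_prob P \<eta> ?\<sigma> ?\<sigma> S = ?s"
    unfolding prob c trace_bell_form n by simp
  have "bsm_post_state P \<eta> ?\<sigma> ?\<sigma> S = (1 / ?s) *\<^sub>R conditional_op ?E ?\<sigma> ?\<sigma>"
    unfolding bsm_post_state_def Let_def p trace_bc_sandwich(1)[OF op_sqrt_bsm_element_square[OF P \<eta>]] ..
  also have "\<dots> = bell_form (swap_p P \<eta> p r) (swap_r P \<eta> p r) (herald_sign S * swap_k P \<eta> k)"
    using s by (simp add: c scaleR_bell_form)
  finally show "heralded_state P \<eta> ?\<sigma> ?\<sigma> S =
      bell_form (swap_p P \<eta> p r) (swap_r P \<eta> p r) (swap_k P \<eta> k)"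
    by (auto simp: heralded_state_def phase_flip_bell_form herald_sign_def)
qed

lemma swap_bell_form:
  assumes "P \<in> {0..1}" "\<eta> \<in> {0..1}" "bsm_s P \<eta> \<noteq> 0" "p + r = 1 / 2"
  shows "swap_prob P \<eta> (bell_form p r k) (bell_form p r k) = 4 * bsm_s P \<eta>"
    and "swapped_state P \<eta> (bell_form p r k) (bell_form p r k) =
      bell_form (swap_p P \<eta> p r) (swap_r P \<eta> p r) (swap_k P \<eta> k)"
proof -
  have "card bsm_successes = 4"
    by (simp add: bsm_successes_def doubleton_eq_iff)
  then show "swap_prob P \<eta> (bell_form p r k) (bell_form p r k) = 4 * bsm_s P \<eta>"
    using assms by (simp add: swap_prob_def bsm_bell_form)
  show "swapped_state P \<eta> (bell_form p r k) (bell_form p r k) =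
      bell_form (swap_p P \<eta> p r) (swap_r P \<eta> p r) (swap_k P \<eta> k)"
    unfolding swapped_state_def
  proof (rule the_equality)
    show "\<forall>S\<in>bsm_successes. heralded_state P \<eta> (bell_form p r k) (bell_form p r k) S =
      bell_form (swap_p P \<eta> p r) (swap_r P \<eta> p r) (swap_k P \<eta> k)"
      using assms by (simp add: bsm_bell_form)
    \<comment> \<open>Uniqueness comes from the existence of at least one successful
      outcome.\<close>
    then show "\<rho> = bell_form (swap_p P \<eta> p r) (swap_r P \<eta> p r) (swap_k P \<eta> k)"
      if "\<forall>S\<in>bsm_successes. heralded_state P \<eta> (bell_form p r k) (bell_form p r k) S = \<rho>" for \<rho>
      using that by (auto simp: bsm_successes_def)
  qed
qed

section \<open>The visibility recursion\<close>

text \<open>Up to the factor 8, \<open>a\<close> collects the two squares and \<open>b\<close> the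
  cross term of one binomial.\<close>

lemma bsm_ab: "bsm_a P \<eta> + bsm_b P \<eta> = (P * (1 - bsm_A P \<eta>) + bsm_A P \<eta> * (1 - P))\<^sup>2 / 8"
  by (simp add: bsm_a_def bsm_b_def power2_eq_square field_simps)

lemma bsm_ab_pos:
  assumes "P \<in> {0..<1}" "\<eta> \<in> {0<..1}"
  shows "bsm_a P \<eta> + bsm_b P \<eta> > 0"
proof -
  have "1 - bsm_A P \<eta> = (1 - P) * (1 - \<eta>)"
    by (simp add: bsm_A_def algebra_simps)
  then have "P * (1 - bsm_A P \<eta>) \<ge> 0" using assms by simp
  moreover have "bsm_A P \<eta> > 0" using assms by (simp add: bsm_A_def add_pos_nonneg)
  ultimately have "P * (1 - bsm_A P \<eta>) + bsm_A P \<eta> * (1 - P) > 0"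
    using assms by (simp add: add_nonneg_pos)
  then show ?thesis by (simp add: bsm_ab)
qed

lemma bsm_c_nonneg:
  assumes "P \<in> {0..1}" "\<eta> \<in> {0..1}"
  shows "bsm_c P \<eta> \<ge> 0"
proof -
  have "(1 - P) * (1 - \<eta>)\<^sup>2 \<in> {0..1}"
    using assms by (simp add: mult_le_one power_le_one)
  then show ?thesis using assms by (simp add: bsm_c_def bsm_B_def)
qed

lemma bsm_s_pos:
  assumes "P \<in> {0..<1}" "\<eta> \<in> {0<..1}"
  shows "bsm_s P \<eta> > 0"
  using bsm_ab_pos[OF assms] bsm_c_nonneg[of P \<eta>] assms by (simp add: bsm_s_def)

definition bsm_t :: "real \<Rightarrow> real \<Rightarrow> real" where
  "bsm_t P \<eta> = (bsm_a P \<eta> + bsm_b P \<eta> - 2 * bsm_c P \<eta>) / bsm_s P \<eta>"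

text \<open>Expanding the fraction by \<open>a + b\<close> turns the form in \<open>w\<close> into
  the contraction factor of the recursion.\<close>

lemma bsm_t_eq:
  assumes "bsm_a P \<eta> + bsm_b P \<eta> \<noteq> 0" and w: "w = bsm_c P \<eta> / (bsm_a P \<eta> + bsm_b P \<eta>)"
  shows "(1 - 2 * w) / (1 + 2 * w) = bsm_t P \<eta>"
proof -
  let ?d = "bsm_a P \<eta> + bsm_b P \<eta>"
  have "?d * w = bsm_c P \<eta>" using assms by simp
  then have "?d * (1 - 2 * w) = ?d - 2 * bsm_c P \<eta>" "?d * (1 + 2 * w) = bsm_s P \<eta>"
    by (simp_all add: bsm_s_def algebra_simps)
  then show ?thesis
    by (subst mult_divide_mult_cancel_left[OF assms(1), symmetric]) (simp only: bsm_t_def)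
qed

text \<open>This is where \<open>P\<^sub>r \<noteq> 1 / 2\<close> is needed for \<open>t\<^sub>r \<noteq> 0\<close>.\<close>

lemma bsm_contrast:
  "bsm_a P \<eta> + bsm_b P \<eta> - 2 * bsm_c P \<eta> = (1 - P)\<^sup>2 * (1 - 2 * P) * \<eta>\<^sup>2 / 8"
  by (simp add: bsm_ab bsm_c_def bsm_A_def bsm_B_def power2_eq_square field_simps)

lemma bsm_t_nonzero:
  assumes "P \<in> {0..<1}" "\<eta> \<in> {0<..1}" "P \<noteq> 1 / 2"
  shows "bsm_t P \<eta> \<noteq> 0"
  using bsm_s_pos[OF assms(1,2)] assms by (simp add: bsm_t_def bsm_contrast)

lemma bsm_t_no_dark_clicks:
  assumes "\<eta> \<in> {0<..1}"
  shows "bsm_t 0 \<eta> = 1"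
  using bsm_s_pos[of 0 \<eta>] assms by (simp add: bsm_t_def bsm_s_def bsm_c_def)

text \<open>Builds in the normalisation \<open>p + r = 1 / 2\<close> and keeps the visibility
  \<open>u = 2 (p - r)\<close>; the coherence remains as a second argument.\<close>

definition bell_mixture :: "real \<Rightarrow> real \<Rightarrow> four_mode_op" where
  "bell_mixture u = bell_form ((1 + u) / 4) ((1 - u) / 4)"

text \<open>Here \<open>p^2 + r^2 = (1 + u^2) / 8\<close> and \<open>2 p r = (1 - u^2) / 8\<close>:
  the terms linear in \<open>u\<close> cancel, which leaves a purely quadratic recursion.\<close>

lemma swap_bell_mixture:
  assumes "P \<in> {0..<1}" "\<eta> \<in> {0<..1}"
  shows "swap_prob P \<eta> (bell_mixture u k) (bell_mixture u k) = 4 * bsm_s P \<eta>"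
    and "swapped_state P \<eta> (bell_mixture u k) (bell_mixture u k) =
      bell_mixture (bsm_t P \<eta> * u\<^sup>2) (swap_k P \<eta> k)"
proof -
  have *: "P \<in> {0..1}" "\<eta> \<in> {0..1}" "bsm_s P \<eta> \<noteq> 0" "(1 + u) / 4 + (1 - u) / 4 = 1 / 2"
    using assms bsm_s_pos[OF assms] by (auto simp: field_simps)
  show "swap_prob P \<eta> (bell_mixture u k) (bell_mixture u k) = 4 * bsm_s P \<eta>"
    unfolding bell_mixture_def by (rule swap_bell_form(1)[OF *])
  let ?p = "(1 + u) / 4" and ?r = "(1 - u) / 4"
    and ?d = "bsm_a P \<eta> + bsm_b P \<eta> - 2 * bsm_c P \<eta>"
  have num:
    "2 * (bsm_a P \<eta> + bsm_b P \<eta>) * (?p\<^sup>2 + ?r\<^sup>2) + 8 * bsm_c P \<eta> * ?p * ?r = (bsm_s P \<eta> + ?d * u\<^sup>2) / 4"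
    "4 * bsm_c P \<eta> * (?p\<^sup>2 + ?r\<^sup>2) + 4 * (bsm_a P \<eta> + bsm_b P \<eta>) * ?p * ?r = (bsm_s P \<eta> - ?d * u\<^sup>2) / 4"
    by (simp_all add: bsm_s_def power2_eq_square field_simps)
  have quot: "(s + d * z) / 4 / s = (1 + d / s * z) / 4" "(s - d * z) / 4 / s = (1 - d / s * z) / 4"
    if "s \<noteq> 0" for s d z :: real
    using that by (simp_all add: field_simps)
  have "swap_p P \<eta> ?p ?r = (1 + bsm_t P \<eta> * u\<^sup>2) / 4" "swap_r P \<eta> ?p ?r = (1 - bsm_t P \<eta> * u\<^sup>2) / 4"
    unfolding swap_p_def swap_r_def bsm_t_def num quot[OF *(3)] by (rule refl)+
  then show "swapped_state P \<eta> (bell_mixture u k) (bell_mixture u k) =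
      bell_mixture (bsm_t P \<eta> * u\<^sup>2) (swap_k P \<eta> k)"
    unfolding bell_mixture_def swap_bell_form(2)[OF *] by (simp only:)
qed

lemma pure_M_plus_eq_bell_mixture: "pure_state M_plus = bell_mixture 1 (1 / 2)"
  by (simp add: pure_M_plus bell_mixture_def)

text \<open>Multiplying \<open>u' = t u^2\<close> by \<open>t\<close> shows that \<open>t u\<close>
  is squared at each level, hence the doubly exponential solution and the division by
  \<open>t\<close>. The coherence is existential because later probabilities depend on
  \<open>u\<close> alone.\<close>

lemma chain_state_eq_bell_mixture:
  assumes "P\<^sub>e \<in> {0..<1}" "x\<^sub>e \<in> {0<..1}" and r: "P\<^sub>r \<in> {0..<1}" "x\<^sub>r \<in> {0<..1}" "P\<^sub>r \<noteq> 1 / 2"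
  shows "\<exists>k. chain_state P\<^sub>e x\<^sub>e P\<^sub>r x\<^sub>r (Suc i) =
    bell_mixture ((bsm_t P\<^sub>r x\<^sub>r * bsm_t P\<^sub>e x\<^sub>e) ^ 2 ^ i / bsm_t P\<^sub>r x\<^sub>r) k"
proof (induction i)
  case 0
  then show ?case
    using bsm_t_nonzero[OF r] by (auto simp: pure_M_plus_eq_bell_mixture swap_bell_mixture(2)[OF assms(1,2)])
next
  case (Suc i)
  have "t * (z ^ 2 ^ i / t)\<^sup>2 = z ^ 2 ^ Suc i / t" if "t \<noteq> 0" for t z :: real
  proof -
    have "z ^ 2 ^ Suc i = (z ^ 2 ^ i)\<^sup>2" by (simp only: power_Suc2 power_mult)
    then show ?thesis using that by (simp add: power2_eq_square)
  qed
  with Suc show ?case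
    using bsm_t_nonzero[OF r] by (auto simp: Let_def swap_bell_mixture(2)[OF r(1,2)])
qed

text \<open>Adding a level squares the old product and appends one factor \<open>x\<close>, in
  accordance with \<open>2 (2^n - 1) + 1 = 2^(n+1) - 1\<close>.\<close>

lemma chain_level_product:
  fixes f :: "nat \<Rightarrow> 'a::comm_semiring_1"
  assumes "\<forall>i\<in>{2..n + 1}. f i = x"
  shows "(\<Prod>i = 1..n + 1. f i ^ 2 ^ (n + 1 - i)) = x ^ (2 ^ n - 1) * f 1 ^ 2 ^ n"
  using assms
proof (induction n)
  case 0
  then show ?case by simp
next
  case (Suc n)
  have "f i ^ 2 ^ (Suc n + 1 - i) = (f i ^ 2 ^ (n + 1 - i))\<^sup>2" if "i \<in> {1..n + 1}" for i
  proof -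
    have "Suc n + 1 - i = Suc (n + 1 - i)" using that by auto
    then show ?thesis by (simp only: power_Suc2 power_mult)
  qed
  then have "(\<Prod>i = 1..n + 1. f i ^ 2 ^ (Suc n + 1 - i)) = (\<Prod>i = 1..n + 1. f i ^ 2 ^ (n + 1 - i))\<^sup>2"
    unfolding prod_power_distrib by (intro prod.cong refl)
  also have "\<dots> = (x ^ (2 ^ n - 1) * f 1 ^ 2 ^ n)\<^sup>2"
    using Suc by simp
  finally have "(\<Prod>i = 1..Suc n + 1. f i ^ 2 ^ (Suc n + 1 - i))
      = x * ((x ^ (2 ^ n - 1))\<^sup>2 * (f 1 ^ 2 ^ n)\<^sup>2)"
    using Suc.prems by (simp add: power_mult_distrib mult.commute)
  \<comment> \<open>Natural subtraction is exact here because \<open>2 ^ n\<close> is at least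
    1.\<close>
  moreover have "Suc ((2 ^ n - 1) * 2) = 2 ^ Suc n - (1 :: nat)"
    unfolding power_Suc using one_le_power[of "2 :: nat" n] by arith
  then have "x * (x ^ (2 ^ n - 1))\<^sup>2 = x ^ (2 ^ Suc n - 1)"
    by (metis power_Suc power_mult)
  moreover have "(f 1 ^ 2 ^ n)\<^sup>2 = f 1 ^ 2 ^ Suc n"
    by (simp only: power_Suc2 power_mult)
  ultimately show ?case
    by (simp only: mult.assoc[symmetric])
qed

section \<open>Sifting, error rate and choice of bases\<close>

lemma trace_mult_scaleR: "trace (A ** (t *\<^sub>R B)) = t *\<^sub>R trace (A ** B :: complex^'n::finite^'n)"
  by (simp add: trace_def matrix_matrix_mult_def scaleR_sum_right)

text \<open>Detecting one qubit gives the single correct click with probability \<open>q\<^sub>1\<close>, the single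
  wrong click with \<open>q\<^sub>2\<close> and the double click with \<open>q\<^sub>3\<close>.\<close>

lemma sift_qber_bell_mixture:
  fixes P \<eta> u k q\<^sub>1 q\<^sub>2 q\<^sub>3 :: real
  assumes q: "q\<^sub>1 = (1 - P) * bsm_A P \<eta>" "q\<^sub>2 = (1 - bsm_A P \<eta>) * P" "q\<^sub>3 = P * bsm_A P \<eta>"
  shows "sift_prob P \<eta> (bell_mixture u k) = (q\<^sub>1 + q\<^sub>2 + q\<^sub>3)\<^sup>2"
    and "q\<^sub>1 + q\<^sub>2 + q\<^sub>3 \<noteq> 0 \<Longrightarrow> qber P \<eta> (bell_mixture u k)
      = 1/2 * (1 - ((q\<^sub>1 - q\<^sub>2) / (q\<^sub>1 + q\<^sub>2 + q\<^sub>3))\<^sup>2 * u)"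
proof -
  have clicks:
    "click_prob P \<eta> (Suc 0) One * click_prob P \<eta> 0 Zero = q\<^sub>1"
    "click_prob P \<eta> 0 Zero * click_prob P \<eta> (Suc 0) One = q\<^sub>1"
    "click_prob P \<eta> 0 One * click_prob P \<eta> (Suc 0) Zero = q\<^sub>2"
    "click_prob P \<eta> (Suc 0) Zero * click_prob P \<eta> 0 One = q\<^sub>2"
    "click_prob P \<eta> (Suc 0) One * click_prob P \<eta> (Suc 0) Zero = q\<^sub>3"
    "click_prob P \<eta> (Suc 0) Zero * click_prob P \<eta> (Suc 0) One = q\<^sub>3"
    by (simp_all add: click_prob_simps q)
  note simps = Let_def four_detectors_eq_diag_op bell_mixture_def matrix_add_ldistrib trace_add
    trace_mult_scaleR trace_bell_form_mult_diag_op click_pattern_prob_def clicks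
  show sift: "sift_prob P \<eta> (bell_mixture u k) = (q\<^sub>1 + q\<^sub>2 + q\<^sub>3)\<^sup>2"
    by (simp add: sift_prob_def simps) (simp add: power2_eq_square field_simps)
  assume "q\<^sub>1 + q\<^sub>2 + q\<^sub>3 \<noteq> 0"
  \<comment> \<open>Double clicks count half as errors and cancel in agreements minus errors. That
    difference is \<open>(q\<^sub>1 - q\<^sub>2)\<^sup>2 * u\<close>, and errors are half of sift
    probability minus it.\<close>
  have "Re (trace (bell_mixture u k ** (four_detectors P \<eta> 0 1 0 1 + four_detectors P \<eta> 1 0 1 0
      + (1 / 2) *\<^sub>R (four_detectors P \<eta> 1 1 0 1 + four_detectors P \<eta> 1 1 1 0 + four_detectors P \<eta> 0 1 1 1
        + four_detectors P \<eta> 1 0 1 1 + four_detectors P \<eta> 1 1 1 1))))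
      = ((q\<^sub>1 + q\<^sub>2 + q\<^sub>3)\<^sup>2 - (q\<^sub>1 - q\<^sub>2)\<^sup>2 * u) / 2"
    by (simp add: simps) (simp add: power2_eq_square field_simps)
  then show "qber P \<eta> (bell_mixture u k) = 1/2 * (1 - ((q\<^sub>1 - q\<^sub>2) / (q\<^sub>1 + q\<^sub>2 + q\<^sub>3))\<^sup>2 * u)"
    using \<open>q\<^sub>1 + q\<^sub>2 + q\<^sub>3 \<noteq> 0\<close> unfolding qber_def Let_def sift power_divide
    by (simp add: diff_divide_distrib)
qed

lemma prob_equal_bases: "measure_pmf.prob basis_choices {(x, y). x = y} = 1 / 2"
proof -
  have "{(x, y). x = y} = {(False, False), (True, True)}" by auto
  then have "measure_pmf.prob basis_choices {(x, y). x = y} = sum (pmf basis_choices) {(False, False), (True, True)}"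
    by (simp only: measure_measure_pmf_finite finite_insert finite.emptyI)
  also have "\<dots> = 1 / 2"
    by (simp add: basis_choices_def pmf_pair)
  finally show ?thesis .
qed

theorem theorem1:
  fixes n M N :: nat
    and \<eta>\<^sub>e \<eta>\<^sub>r \<eta>\<^sub>d lam lam\<^sub>m P\<^sub>e P\<^sub>r P\<^sub>d :: real
    and A\<^sub>r B\<^sub>r a b c A\<^sub>e B\<^sub>e a\<^sub>e b\<^sub>e c\<^sub>e s s\<^sub>1 w\<^sub>r w\<^sub>1 A\<^sub>d q\<^sub>1 q\<^sub>2 q\<^sub>3 t\<^sub>e t\<^sub>r t\<^sub>d P_succ :: real
    and \<rho> :: "nat \<Rightarrow> four_mode_op"
    and P\<^sub>s P\<^sub>1 Q :: "nat \<Rightarrow> real"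
  assumes "N = 2 ^ n" and "M \<ge> 1"
    and "\<eta>\<^sub>e \<in> {0<..1}" and "\<eta>\<^sub>r \<in> {0<..1}" and "\<eta>\<^sub>d \<in> {0<..1}"
    and "lam \<in> {0<..1}" and "lam\<^sub>m \<in> {0<..1}"
    and "P\<^sub>e \<in> {0..<1}" and "P\<^sub>r \<in> {0..<1}" and "P\<^sub>d \<in> {0..<1}" and "P\<^sub>r \<noteq> 1 / 2"
    and "\<rho> = chain_state P\<^sub>e (\<eta>\<^sub>e * lam) P\<^sub>r (\<eta>\<^sub>r * lam\<^sub>m)"
    and "P\<^sub>s = level_prob M P\<^sub>e (\<eta>\<^sub>e * lam) P\<^sub>r (\<eta>\<^sub>r * lam\<^sub>m)"
    and "P_succ = chain_prob M P\<^sub>e (\<eta>\<^sub>e * lam) P\<^sub>r (\<eta>\<^sub>r * lam\<^sub>m) n"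
    and "P\<^sub>1 = (\<lambda>i. sift_prob P\<^sub>d \<eta>\<^sub>d (\<rho> i))"
    and "Q = (\<lambda>i. qber P\<^sub>d \<eta>\<^sub>d (\<rho> i))"
    and "A\<^sub>r = \<eta>\<^sub>r * lam\<^sub>m + P\<^sub>r * (1 - \<eta>\<^sub>r * lam\<^sub>m)"
    and "B\<^sub>r = 1 - (1 - P\<^sub>r) * (1 - \<eta>\<^sub>r * lam\<^sub>m)^2"
    and "a = 1/8 * (P\<^sub>r^2 * (1 - A\<^sub>r)^2 + A\<^sub>r^2 * (1 - P\<^sub>r)^2)"
    and "b = 1/8 * (2 * A\<^sub>r * P\<^sub>r * (1 - A\<^sub>r) * (1 - P\<^sub>r))"
    and "c = 1/8 * P\<^sub>r * (1 - P\<^sub>r) * (P\<^sub>r * (1 - B\<^sub>r) + B\<^sub>r * (1 - P\<^sub>r))"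
    and "A\<^sub>e = \<eta>\<^sub>e * lam + P\<^sub>e * (1 - \<eta>\<^sub>e * lam)"
    and "B\<^sub>e = 1 - (1 - P\<^sub>e) * (1 - \<eta>\<^sub>e * lam)^2"
    and "a\<^sub>e = 1/8 * (P\<^sub>e^2 * (1 - A\<^sub>e)^2 + A\<^sub>e^2 * (1 - P\<^sub>e)^2)"
    and "b\<^sub>e = 1/8 * (2 * A\<^sub>e * P\<^sub>e * (1 - A\<^sub>e) * (1 - P\<^sub>e))"
    and "c\<^sub>e = 1/8 * P\<^sub>e * (1 - P\<^sub>e) * (P\<^sub>e * (1 - B\<^sub>e) + B\<^sub>e * (1 - P\<^sub>e))"
    and "s = a + b + 2 * c" and "s\<^sub>1 = a\<^sub>e + b\<^sub>e + 2 * c\<^sub>e"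
    and "w\<^sub>r = c / (a + b)" and "w\<^sub>1 = c\<^sub>e / (a\<^sub>e + b\<^sub>e)"
    and "A\<^sub>d = \<eta>\<^sub>d + (1 - \<eta>\<^sub>d) * P\<^sub>d"
    and "q\<^sub>1 = (1 - P\<^sub>d) * A\<^sub>d" and "q\<^sub>2 = (1 - A\<^sub>d) * P\<^sub>d" and "q\<^sub>3 = P\<^sub>d * A\<^sub>d"
    and "t\<^sub>e = (1 - 2 * w\<^sub>1) / (1 + 2 * w\<^sub>1)"
    and "t\<^sub>r = (1 - 2 * w\<^sub>r) / (1 + 2 * w\<^sub>r)"
    and "t\<^sub>d = ((q\<^sub>1 - q\<^sub>2) / (q\<^sub>1 + q\<^sub>2 + q\<^sub>3))^2"
  shows "(measure_pmf.prob basis_choices {(x, y). x = y} = 1 / 2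
      \<and> (\<forall>i\<in>{1..n + 1}. P\<^sub>1 i = (q\<^sub>1 + q\<^sub>2 + q\<^sub>3)^2))
    \<and> ((\<forall>i\<in>{1..n + 1}. Q i = 1/2 * (1 - t\<^sub>d / t\<^sub>r * (t\<^sub>r * t\<^sub>e) ^ 2 ^ (i - 1)))
      \<and> (P\<^sub>e = 0 \<longrightarrow> t\<^sub>e = 1) \<and> (P\<^sub>r = 0 \<longrightarrow> t\<^sub>r = 1) \<and> (P\<^sub>d = 0 \<longrightarrow> t\<^sub>d = 1))
    \<and> (P\<^sub>s 1 = 1 - (1 - 4 * s\<^sub>1) ^ M
      \<and> (\<forall>i\<in>{2..n + 1}. P\<^sub>s i = 4 * s)
      \<and> P_succ = (4 * s) ^ (N - 1) * P\<^sub>s 1 ^ N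
      \<and> P_succ = 1 / (4 * s) * (4 * s * (1 - (1 - 4 * s\<^sub>1) ^ M)) ^ 2 ^ n)"
proof -
  define x\<^sub>e x\<^sub>r where "x\<^sub>e = \<eta>\<^sub>e * lam" and "x\<^sub>r = \<eta>\<^sub>r * lam\<^sub>m"
  have e: "P\<^sub>e \<in> {0..<1}" "x\<^sub>e \<in> {0<..1}" and r: "P\<^sub>r \<in> {0..<1}" "x\<^sub>r \<in> {0<..1}" "P\<^sub>r \<noteq> 1 / 2"
    using assms(3-11) by (auto simp: x\<^sub>e_def x\<^sub>r_def mult_le_one)
  have AB: "A\<^sub>r = bsm_A P\<^sub>r x\<^sub>r" "B\<^sub>r = bsm_B P\<^sub>r x\<^sub>r" "A\<^sub>e = bsm_A P\<^sub>e x\<^sub>e" "B\<^sub>e = bsm_B P\<^sub>e x\<^sub>e"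
    using assms(17,18,22,23) by (simp_all add: bsm_A_def bsm_B_def x\<^sub>e_def x\<^sub>r_def)
  have abc: "a = bsm_a P\<^sub>r x\<^sub>r" "b = bsm_b P\<^sub>r x\<^sub>r" "c = bsm_c P\<^sub>r x\<^sub>r"
    "a\<^sub>e = bsm_a P\<^sub>e x\<^sub>e" "b\<^sub>e = bsm_b P\<^sub>e x\<^sub>e" "c\<^sub>e = bsm_c P\<^sub>e x\<^sub>e"
    using assms(19-21,24-26) by (simp_all only: AB bsm_a_def bsm_b_def bsm_c_def)
  have s: "s = bsm_s P\<^sub>r x\<^sub>r" "s\<^sub>1 = bsm_s P\<^sub>e x\<^sub>e"
    using assms(27,28) by (simp_all only: abc bsm_s_def)
  have t: "t\<^sub>r = bsm_t P\<^sub>r x\<^sub>r" "t\<^sub>e = bsm_t P\<^sub>e x\<^sub>e"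
    unfolding assms(35,36)
    by (rule bsm_t_eq; use assms(29,30) bsm_ab_pos[OF e] bsm_ab_pos[OF r(1,2)] in \<open>simp only: abc less_irrefl not_False_eq_True\<close>)+
  have "s > 0" using bsm_s_pos[OF r(1,2)] s by simp
  \<comment> \<open>The click probability on one photon has the same form for the final detectors,
    so \<open>bsm_A\<close> is reused.\<close>
  have A\<^sub>d: "A\<^sub>d = bsm_A P\<^sub>d \<eta>\<^sub>d" using assms(31) by (simp add: bsm_A_def mult.commute)
  have q: "q\<^sub>1 = (1 - P\<^sub>d) * bsm_A P\<^sub>d \<eta>\<^sub>d" "q\<^sub>2 = (1 - bsm_A P\<^sub>d \<eta>\<^sub>d) * P\<^sub>d" "q\<^sub>3 = P\<^sub>d * bsm_A P\<^sub>d \<eta>\<^sub>d"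
    using assms(32-34) by (simp_all only: A\<^sub>d)
  have "A\<^sub>d > 0" using assms(5,10,31) by (simp add: add_pos_nonneg)
  \<comment> \<open>The probability of any click on one qubit: the occupied mode clicks, or else the
    empty one gives a dark click.\<close>
  moreover have "q\<^sub>1 + q\<^sub>2 + q\<^sub>3 = A\<^sub>d + (1 - A\<^sub>d) * P\<^sub>d"
    using assms(32-34) by (simp add: algebra_simps)
  moreover have "1 - A\<^sub>d = (1 - \<eta>\<^sub>d) * (1 - P\<^sub>d)" using assms(31) by (simp add: algebra_simps)
  ultimately have q_pos: "q\<^sub>1 + q\<^sub>2 + q\<^sub>3 > 0" using assms(5,10) by (simp add: add_pos_nonneg)
  have chain: "\<exists>k. \<rho> i = bell_mixture ((t\<^sub>r * t\<^sub>e) ^ 2 ^ (i - 1) / t\<^sub>r) k" if "i \<ge> 1" for i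
    using chain_state_eq_bell_mixture[OF e r, of "i - 1"] that
    by (simp add: assms(12) t x\<^sub>e_def x\<^sub>r_def)
  have sift: "P\<^sub>1 i = (q\<^sub>1 + q\<^sub>2 + q\<^sub>3)\<^sup>2"
    and qber: "Q i = 1/2 * (1 - t\<^sub>d / t\<^sub>r * (t\<^sub>r * t\<^sub>e) ^ 2 ^ (i - 1))" if i: "i \<ge> 1" for i
  proof -
    obtain k where k: "\<rho> i = bell_mixture ((t\<^sub>r * t\<^sub>e) ^ 2 ^ (i - 1) / t\<^sub>r) k"
      using chain[OF i] by blast
    show "P\<^sub>1 i = (q\<^sub>1 + q\<^sub>2 + q\<^sub>3)\<^sup>2"
      unfolding assms(15) k by (rule sift_qber_bell_mixture(1)[OF q])
    show "Q i = 1/2 * (1 - t\<^sub>d / t\<^sub>r * (t\<^sub>r * t\<^sub>e) ^ 2 ^ (i - 1))"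
      unfolding assms(16) k using q_pos by (simp add: sift_qber_bell_mixture(2)[OF q] assms(37))
  qed
  have P1: "P\<^sub>s 1 = 1 - (1 - 4 * s\<^sub>1) ^ M"
    unfolding assms(13) level_prob_def pure_M_plus_eq_bell_mixture x\<^sub>e_def[symmetric]
    by (simp add: swap_bell_mixture[OF e] s)
  have Pi: "P\<^sub>s i = 4 * s" if "i \<in> {2..n + 1}" for i
  proof -
    \<comment> \<open>From level 2 on, the preceding level is at least 1, where the chain state is
      specified.\<close>
    have "i - 1 \<ge> 1" "i \<noteq> 1" using that by auto
    then obtain k where k: "\<rho> (i - 1) = bell_mixture ((t\<^sub>r * t\<^sub>e) ^ 2 ^ (i - 1 - 1) / t\<^sub>r) k"
      using chain by blast
    have "P\<^sub>s i = swap_prob P\<^sub>r x\<^sub>r (\<rho> (i - 1)) (\<rho> (i - 1))"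
      using \<open>i \<noteq> 1\<close> by (simp add: assms(12,13) level_prob_def Let_def x\<^sub>e_def x\<^sub>r_def)
    then show ?thesis unfolding k s swap_bell_mixture(1)[OF r(1,2)] .
  qed
  have succ: "P_succ = (4 * s) ^ (N - 1) * P\<^sub>s 1 ^ N"
    unfolding assms(1,14) chain_prob_def assms(13)[symmetric]
    by (rule chain_level_product) (use Pi in blast)
  \<comment> \<open>Since \<open>N\<close> is positive, one factor \<open>4 * s\<close> splits off;
    it accounts for the prefactor \<open>1 / (4 * s)\<close> of the closed form.\<close>
  have "(4 * s) ^ N = 4 * s * (4 * s) ^ (N - 1)"
    using power_minus_mult[of N "4 * s"] assms(1) by (simp only: mult.commute zero_less_power zero_less_numeral)
  then have "P_succ = 1 / (4 * s) * (4 * s * (1 - (1 - 4 * s\<^sub>1) ^ M)) ^ 2 ^ n"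
    using \<open>s > 0\<close> unfolding succ P1 assms(1)[symmetric] by (simp add: power_mult_distrib)
  moreover have "t\<^sub>d = 1" if "P\<^sub>d = 0"
    using that q_pos q assms(37) by simp
  moreover have "P\<^sub>e = 0 \<longrightarrow> t\<^sub>e = 1" "P\<^sub>r = 0 \<longrightarrow> t\<^sub>r = 1"
    using bsm_t_no_dark_clicks e(2) r(2) by (auto simp: t)
  ultimately show ?thesis
    using prob_equal_bases sift qber P1 Pi succ by auto
qed

end
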